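(* If an order $O$ is a PRINC domain, then its integral closure $D$ (in its quotient field) is a PRINC domain, or, equivalently, a principal ideal domain.
   Context: An integral domain $O$ is an order if its integral closure $D$ in its quotient field is a Dedekind domain which is finitely generated as an $O$-module (Dedekind domains are understood not to be fields). Two elements $a,b$ of an integral domain $R$ form an idempotent pair if either $a(1-a)\in bR$ or $b(1-b)\in aR$. $R$ is a PRINC domain if every ideal of $R$ generated by an idempotent pair is principal. *)

theory Defs
  imports "HOL-Algebra.Algebra"
begin

text \<open>
  An integral domain is taken inside its quotient field: it is a subset \<open>A\<close> of the carrier
  of a field \<open>K\<close> such that \<open>A\<close> is a subring and every element of \<open>K\<close> is a fraction of
  elements of \<open>A\<close>. As a ring in its own right it is \<open>K\<lparr>carrier := A\<rparr>\<close>. This loses no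
  generality, since every integral domain embeds into its quotient field.
\<close>

definition quotient_field_of :: "('a, 'b) ring_scheme \<Rightarrow> 'a set \<Rightarrow> bool" where
  "quotient_field_of K A \<longleftrightarrow>
     field K \<and> subdomain A K \<and>
     (\<forall>x \<in> carrier K. \<exists>a \<in> A. \<exists>b \<in> A. b \<noteq> \<zero>\<^bsub>K\<^esub> \<and> x = a \<otimes>\<^bsub>K\<^esub> inv\<^bsub>K\<^esub> b)"

text \<open>Polynomials are coefficient lists, leading coefficient first.\<close>

definition integral_closure :: "('a, 'b) ring_scheme \<Rightarrow> 'a set \<Rightarrow> 'a set" where
  "integral_closure K A =
     {x \<in> carrier K. \<exists>p. p \<noteq> [] \<and> polynomial\<^bsub>K\<^esub> A p \<and> lead_coeff p = \<one>\<^bsub>K\<^esub> \<and>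
        ring.eval K p x = \<zero>\<^bsub>K\<^esub>}"

text \<open>Fields are not Dedekind domains in this convention.\<close>

definition dedekind_domain :: "('a, 'b) ring_scheme \<Rightarrow> 'a set \<Rightarrow> bool" where
  "dedekind_domain K D \<longleftrightarrow>
     quotient_field_of K D \<and>
     \<not> field (K\<lparr>carrier := D\<rparr>) \<and>
     noetherian_domain (K\<lparr>carrier := D\<rparr>) \<and>
     integral_closure K D = D \<and>
     (\<forall>P. primeideal P (K\<lparr>carrier := D\<rparr>) \<and> P \<noteq> {\<zero>\<^bsub>K\<^esub>} \<longrightarrow>
        maximalideal P (K\<lparr>carrier := D\<rparr>))"

text \<open>
  The last conjunct says that the integral closure is a finitely generated \<open>A\<close>-module:
  \<open>ring.Span K A us\<close> is the set of all \<open>A\<close>-linear combinations of the list \<open>us\<close>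
  (\<open>A\<close> need not be a subfield here).
\<close>

definition order_domain :: "('a, 'b) ring_scheme \<Rightarrow> 'a set \<Rightarrow> bool" where
  "order_domain K A \<longleftrightarrow>
     quotient_field_of K A \<and>
     dedekind_domain K (integral_closure K A) \<and>
     (\<exists>us. set us \<subseteq> integral_closure K A \<and> integral_closure K A = ring.Span K A us)"

definition idempotent_pair :: "('a, 'b) ring_scheme \<Rightarrow> 'a \<Rightarrow> 'a \<Rightarrow> bool" where
  "idempotent_pair R a b \<longleftrightarrow>
     a \<in> carrier R \<and> b \<in> carrier R \<and>
     (a \<otimes>\<^bsub>R\<^esub> (\<one>\<^bsub>R\<^esub> \<ominus>\<^bsub>R\<^esub> a) \<in> PIdl\<^bsub>R\<^esub> b \<or>
      b \<otimes>\<^bsub>R\<^esub> (\<one>\<^bsub>R\<^esub> \<ominus>\<^bsub>R\<^esub> b) \<in> PIdl\<^bsub>R\<^esub> a)"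

definition PRINC_domain :: "('a, 'b) ring_scheme \<Rightarrow> bool" where
  "PRINC_domain R \<longleftrightarrow>
     domain R \<and>
     (\<forall>a b. idempotent_pair R a b \<longrightarrow> principalideal (Idl\<^bsub>R\<^esub> {a, b}) R)"

end

theory Submission
  imports Defs
begin

text \<open>
  Let \<open>0 \<noteq> c \<in> A\<close> with \<open>c D \<subseteq> A\<close>; such a \<open>c\<close> exists because \<open>D\<close> is a finitely generated
  \<open>A\<close>-module. Let \<open>P\<close> be a nonzero prime of \<open>D\<close>. Since \<open>P\<close> is invertible, some \<open>b \<in> P\<close>
  satisfies \<open>b P\<^sup>-\<^sup>1 + c\<^sup>2 P = D\<close>, so there is \<open>a \<in> c\<^sup>2 P\<close> with \<open>(1 - a) P \<subseteq> b D\<close>.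
  Then \<open>a\<close> and \<open>c b\<close> lie in \<open>A\<close> and \<open>a (1 - a) \<in> c\<^sup>2 b D \<subseteq> c b A\<close>, so they form an
  idempotent pair of \<open>A\<close>. They generate \<open>c P\<close> over \<open>D\<close>, hence if \<open>A\<close> is a PRINC domain,
  \<open>P\<close> is principal. A Dedekind domain all of whose nonzero primes are principal is a principal
  ideal domain. The case \<open>A = D\<close>, \<open>c = 1\<close> gives the equivalence for \<open>D\<close> itself.
\<close>

section \<open>Maximal members of families of ideals, and ideals of a subring\<close>

text \<open>The form in which the Noetherian property is used below: a nonempty chain of ideals
  contains its own union, so Zorn's lemma applies inside any family of ideals.\<close>

lemma (in noetherian_ring) exists_maximal_in_family:
  assumes "F \<noteq> {}" and ideals: "\<And>I. I \<in> F \<Longrightarrow> ideal I R"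
  shows "\<exists>M\<in>F. \<forall>J\<in>F. M \<subseteq> J \<longrightarrow> J = M"
proof (rule subset_Zorn_nonempty[OF assms(1)])
  fix C assume "C \<noteq> {}" and C: "subset.chain F C"
  then have "subset.chain {I. ideal I R} C"
    using ideals unfolding subset_chain_def by blast
  then have "\<Union>C \<in> C" by (rule ideal_chain_is_trivial[OF \<open>C \<noteq> {}\<close>])
  then show "\<Union>C \<in> F" using C unfolding subset_chain_def by blast
qed

lemma (in ring) a_inv_subring:
  assumes D: "subring D R" and x: "x \<in> D"
  shows "\<ominus>\<^bsub>R\<lparr>carrier := D\<rparr>\<^esub> x = \<ominus> x"
  by (rule abelian_group.minus_equality[OF ring.is_abelian_group[OF subring_is_ring[OF D]]])
    (use x subringE(1,5)[OF D] l_neg in auto)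

text \<open>Ideals of a subring can thus be handled by computing in the ambient ring. Closure under
  negation comes from multiplying by \<open>\<ominus> \<one>\<close>, which lies in
  \<open>D\<close>.\<close>

lemma (in cring) ideal_subring_iff:
  assumes "subring D R"
  shows "ideal I (R\<lparr>carrier := D\<rparr>) \<longleftrightarrow>
    I \<subseteq> D \<and> \<zero> \<in> I \<and> (\<forall>x\<in>I. \<forall>y\<in>I. x \<oplus> y \<in> I) \<and> (\<forall>d\<in>D. \<forall>x\<in>I. d \<otimes> x \<in> I)"
    (is "?l \<longleftrightarrow> ?r")
proof
  assume l: ?l
  note add = additive_subgroup.a_subset additive_subgroup.zero_closed additive_subgroup.a_closed
  show ?r
    using add[OF ideal.axioms(1)[OF l]] ideal.I_l_closed[OF l] by auto
next
  assume r: ?r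
  have ringD: "ring (R\<lparr>carrier := D\<rparr>)" by (rule subring_is_ring[OF assms])
  then have groupD: "abelian_group (R\<lparr>carrier := D\<rparr>)" by (rule ring.is_abelian_group)
  note DE = subringE[OF assms]
  have DK: "d \<in> carrier R" if "d \<in> D" for d using DE(1) that by blast
  have neg: "\<ominus> x \<in> I" if "x \<in> I" for x
  proof -
    have "\<ominus> x = (\<ominus> \<one>) \<otimes> x" using that r DK by (auto simp: l_minus)
    then show ?thesis using r that DE(3,5) by auto
  qed
  show ?l
  proof (rule idealI[OF ringD])
    show "subgroup I (add_monoid (R\<lparr>carrier := D\<rparr>))"
    proof (rule group.subgroupI[OF abelian_group.a_group[OF groupD]], goal_cases)
      case (3 x)
      then have "\<ominus>\<^bsub>R\<lparr>carrier := D\<rparr>\<^esub> x = \<ominus> x" using r by (intro a_inv_subring[OF assms]) auto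
      then show ?case using neg 3 by (simp add: a_inv_def)
    qed (use r in auto)
    fix a x assume "a \<in> I" "x \<in> carrier (R\<lparr>carrier := D\<rparr>)"
    then show "x \<otimes>\<^bsub>R\<lparr>carrier := D\<rparr>\<^esub> a \<in> I" "a \<otimes>\<^bsub>R\<lparr>carrier := D\<rparr>\<^esub> x \<in> I"
      using r m_comm[of a x] DK by auto
  qed
qed

section \<open>The Dedekind domain \<open>D\<close> inside its quotient field, and
  integrality\<close>

text \<open>Keeping \<open>K\<close> as the ambient structure lets elements of \<open>D\<close> be
  multiplied by fractions, as inverses of ideals require.\<close>

locale dedekind_subring = field K for K (structure) +
  fixes D :: "'a set"
  assumes dedekind: "dedekind_domain K D"
begin

abbreviation (input) "R \<equiv> K\<lparr>carrier := D\<rparr>"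

sublocale D: noetherian_domain R
  using dedekind by (simp add: dedekind_domain_def)

lemma subring_D: "subring D K"
  using dedekind subdomain.axioms(1) subcring.axioms(1)
  unfolding dedekind_domain_def quotient_field_of_def by blast

lemma D_carrier [simp]: "x \<in> D \<Longrightarrow> x \<in> carrier K"
  using subringE(1)[OF subring_D] by blast

lemma D_zero [simp]: "\<zero> \<in> D" and D_one [simp]: "\<one> \<in> D"
  and D_neg [simp]: "x \<in> D \<Longrightarrow> \<ominus> x \<in> D"
  and D_mult [simp]: "x \<in> D \<Longrightarrow> y \<in> D \<Longrightarrow> x \<otimes> y \<in> D"
  and D_add [simp]: "x \<in> D \<Longrightarrow> y \<in> D \<Longrightarrow> x \<oplus> y \<in> D"
  using subringE[OF subring_D] by auto

lemma D_minus [simp]: "x \<in> D \<Longrightarrow> y \<in> D \<Longrightarrow> x \<ominus> y \<in> D"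
  by (simp add: a_minus_def)

lemma ideal_R_iff:
  "ideal I R \<longleftrightarrow>
    I \<subseteq> D \<and> \<zero> \<in> I \<and> (\<forall>x\<in>I. \<forall>y\<in>I. x \<oplus> y \<in> I) \<and> (\<forall>d\<in>D. \<forall>x\<in>I. d \<otimes> x \<in> I)"
  by (rule ideal_subring_iff[OF subring_D])

lemma ideal_diff:
  assumes "ideal I R" "x \<in> I" "y \<in> I" shows "x \<ominus> y \<in> I"
proof -
  have "x \<in> D" "y \<in> D" using assms ideal_R_iff by auto
  then have "x \<ominus> y = x \<oplus> (\<ominus> \<one>) \<otimes> y" by (simp add: a_minus_def l_minus)
  then show ?thesis using assms ideal_R_iff by auto
qed

text \<open>Instead of the determinant trick: for \<open>0 \<noteq> x \<in> I\<close> the ideals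
  \<open>x (D + D y + \<dots> + D y\<^sup>n)\<close> of \<open>D\<close> stabilise, which yields a monic equation for \<open>y\<close>.\<close>

lemma integral_multiplier_mem:
  assumes I: "ideal I R" and x: "x \<in> I" "x \<noteq> \<zero>"
    and y: "y \<in> carrier K" and yI: "\<And>z. z \<in> I \<Longrightarrow> y \<otimes> z \<in> I"
  shows "y \<in> D"
proof -
  \<comment> \<open>Lists of length \<open>n\<close> give the powers below \<open>y^n\<close>, so
    \<open>J n\<close> is \<open>x (D + D y + ... + D y^(n-1))\<close>. Leading zeros are allowed,
    which makes \<open>J\<close> increasing and lists of equal length easy to add.\<close>
  define J where "J n = {x \<otimes> eval p y | p. set p \<subseteq> D \<and> length p = n}" for n
  have ev: "eval p y \<in> carrier K" if "set p \<subseteq> D" for p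
    using that y by (intro eval_in_carrier) auto
  have xK: "x \<in> carrier K" using I x ideal_R_iff by auto
  have pow: "x \<otimes> y [^] (n::nat) \<in> I" for n
  proof (induction n)
    case (Suc n)
    have "x \<otimes> y [^] Suc n = y \<otimes> (x \<otimes> y [^] n)"
      using xK y by (simp add: m_ac)
    then show ?case using yI[OF Suc] by simp
  qed (use x xK in simp)
  have sub: "x \<otimes> eval p y \<in> I" if "set p \<subseteq> D" for p
    using that
  proof (induction p)
    case Nil then show ?case using xK I ideal_R_iff by simp
  next
    case (Cons d p)
    have "x \<otimes> eval (d # p) y = d \<otimes> (x \<otimes> y [^] length p) \<oplus> x \<otimes> eval p y"
      using Cons.prems xK y ev[of p] by (simp add: r_distr m_ac)
    then show ?case using Cons pow I ideal_R_iff by auto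
  qed
  have add: "eval p y \<oplus> eval q y = eval (map2 (\<oplus>) p q) y \<and> set (map2 (\<oplus>) p q) \<subseteq> D"
    if "length p = length q" "set p \<subseteq> D" "set q \<subseteq> D" for p q
    using that
  proof (induction rule: list_induct2)
    case (Cons a p b q)
    then have IH: "eval (map2 (\<oplus>) p q) y = eval p y \<oplus> eval q y"
      "set (map2 (\<oplus>) p q) \<subseteq> D" by auto
    have "a \<in> carrier K" "b \<in> carrier K" "eval p y \<in> carrier K" "eval q y \<in> carrier K"
      "y [^] length q \<in> carrier K"
      using Cons.prems ev y by auto
    then have "a \<otimes> y [^] length q \<oplus> eval p y \<oplus> (b \<otimes> y [^] length q \<oplus> eval q y)
        = (a \<oplus> b) \<otimes> y [^] length q \<oplus> (eval p y \<oplus> eval q y)"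
      by algebra
    then show ?case using Cons.hyps Cons.prems IH by simp
  qed auto
  have smult: "d \<otimes> eval p y = eval (map ((\<otimes>) d) p) y \<and> set (map ((\<otimes>) d) p) \<subseteq> D"
    if "d \<in> D" "set p \<subseteq> D" for d p
    using that(2)
  proof (induction p)
    case (Cons a p)
    then show ?case using that(1) ev[of p] y by (auto simp: r_distr m_assoc)
  qed (use that in auto)
  have JI: "ideal (J n) R" for n
    unfolding ideal_R_iff
  proof (intro conjI ballI)
    show "J n \<subseteq> D" using sub I ideal_R_iff unfolding J_def by auto
    have "eval (replicate n \<zero>) y = \<zero>"
      using eval_replicate[of "[]" y n] y by simp
    then show "\<zero> \<in> J n" unfolding J_def
      using xK by (intro CollectI exI[of _ "replicate n \<zero>"]) auto
  next
    fix u v assume "u \<in> J n" "v \<in> J n"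
    then obtain p q where pq: "u = x \<otimes> eval p y" "v = x \<otimes> eval q y"
      "set p \<subseteq> D" "set q \<subseteq> D" "length p = n" "length q = n" unfolding J_def by auto
    then show "u \<oplus> v \<in> J n" unfolding J_def
      using add[of p q] ev[of p] ev[of q] xK
      by (intro CollectI exI[of _ "map2 (\<oplus>) p q"]) (simp add: r_distr[symmetric])
  next
    fix d u assume d: "d \<in> D" and "u \<in> J n"
    then obtain p where p: "u = x \<otimes> eval p y" "set p \<subseteq> D" "length p = n"
      unfolding J_def by auto
    have "d \<otimes> u = x \<otimes> (d \<otimes> eval p y)" using p d ev[of p] xK by (simp add: m_ac)
    then show "d \<otimes> u \<in> J n" unfolding J_def using smult[OF d p(2)] p(3)
      by (intro CollectI exI[of _ "map ((\<otimes>) d) p"]) simp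
  qed
  have "\<exists>M\<in>range J. \<forall>I\<in>range J. M \<subseteq> I \<longrightarrow> I = M"
    by (rule D.exists_maximal_in_family) (use JI in auto)
  then obtain n where n: "\<And>m. J n \<subseteq> J m \<Longrightarrow> J m = J n" by auto
  have "J n \<subseteq> J (Suc n)"
  proof
    fix u assume "u \<in> J n"
    then obtain p where p: "u = x \<otimes> eval p y" "set p \<subseteq> D" "length p = n"
      unfolding J_def by auto
    then show "u \<in> J (Suc n)" unfolding J_def
      using ev[of p] y by (intro CollectI exI[of _ "\<zero> # p"]) simp
  qed
  then have eq: "J (Suc n) = J n" using n by blast
  \<comment> \<open>\<open>monom \<one> n\<close> is the list of \<open>X^n\<close>, of length
    \<open>Suc n\<close>, so \<open>x y^n\<close> lies in \<open>J (Suc n) = J n\<close>. Cancelling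
    \<open>x\<close> expresses \<open>y^n\<close> by lower powers, a monic equation for
    \<open>y\<close>.\<close>
  have "eval (monom \<one> n) y = y [^] n" using eval_monom[of \<one> y n] y by simp
  moreover have "set (monom \<one> n) \<subseteq> D" "length (monom \<one> n) = Suc n"
    by (auto simp: monom_def)
  ultimately have "x \<otimes> y [^] n \<in> J (Suc n)" unfolding J_def
    by (intro CollectI exI[of _ "monom \<one> n"]) simp
  then obtain p where p: "x \<otimes> y [^] n = x \<otimes> eval p y" "set p \<subseteq> D" "length p = n"
    unfolding eq unfolding J_def by blast
  then have yn: "y [^] n = eval p y"
    using x(2) xK y ev[OF p(2)] m_lcancel[of x "y [^] n" "eval p y"] by simp
  have "eval (\<one> # map ((\<otimes>) (\<ominus> \<one>)) p) y = y [^] n \<oplus> (\<ominus> \<one>) \<otimes> eval p y"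
    using smult[of "\<ominus> \<one>" p] p y by simp
  also have "\<dots> = \<zero>" using yn ev[of p] p y by (simp add: l_minus r_neg)
  finally have root: "eval (\<one> # map ((\<otimes>) (\<ominus> \<one>)) p) y = \<zero>" .
  have "set (\<one> # map ((\<otimes>) (\<ominus> \<one>)) p) \<subseteq> D"
    using smult[OF D_neg[OF D_one] p(2)] by simp
  then have "y \<in> integral_closure K D"
    unfolding integral_closure_def polynomial_def using y root
    by (intro CollectI conjI exI[of _ "\<one> # map ((\<otimes>) (\<ominus> \<one>)) p"])
      (simp_all del: eval.simps)
  then show ?thesis using dedekind by (simp add: dedekind_domain_def)
qed

section \<open>Ideals of \<open>D\<close> and sums \<open>I + y J\<close>\<close>

lemma ideal_subset: "ideal I R \<Longrightarrow> x \<in> I \<Longrightarrow> x \<in> D"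
  and ideal_zero: "ideal I R \<Longrightarrow> \<zero> \<in> I"
  and ideal_add: "ideal I R \<Longrightarrow> x \<in> I \<Longrightarrow> y \<in> I \<Longrightarrow> x \<oplus> y \<in> I"
  and ideal_mult: "ideal I R \<Longrightarrow> d \<in> D \<Longrightarrow> x \<in> I \<Longrightarrow> d \<otimes> x \<in> I"
  by (auto simp: ideal_R_iff)

lemma ideal_carrier: "ideal D R"
  by (simp add: ideal_R_iff)

lemma ideal_eq_carrier: "ideal I R \<Longrightarrow> \<one> \<in> I \<Longrightarrow> I = D"
  using ideal_mult[of I _ \<one>] ideal_subset[of I] by fastforce

text \<open>The sum \<open>I + y J\<close>, where \<open>y\<close> may be a fraction. It covers
  principal ideals (\<open>I = {\<zero>}\<close>, \<open>J = D\<close>), adjoining an element of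
  \<open>D\<close> to \<open>I\<close> (\<open>J = D\<close>), and \<open>P + y P\<close>.\<close>

definition sum_scaled :: "'a set \<Rightarrow> 'a \<Rightarrow> 'a set \<Rightarrow> 'a set" where
  "sum_scaled I y J = {m \<oplus> y \<otimes> n | m n. m \<in> I \<and> n \<in> J}"

lemma sum_scaledI: "m \<in> I \<Longrightarrow> n \<in> J \<Longrightarrow> m \<oplus> y \<otimes> n \<in> sum_scaled I y J"
  unfolding sum_scaled_def by blast

lemma sum_scaledE:
  assumes "x \<in> sum_scaled I y J"
  obtains m n where "m \<in> I" "n \<in> J" "x = m \<oplus> y \<otimes> n"
  using assms unfolding sum_scaled_def by blast

lemma ideal_sum_scaled:
  assumes I: "ideal I R" and J: "ideal J R" and y: "y \<in> carrier K"
    and yJ: "\<And>n. n \<in> J \<Longrightarrow> y \<otimes> n \<in> D"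
  shows "ideal (sum_scaled I y J) R"
  unfolding ideal_R_iff
proof (intro conjI ballI subsetI)
  fix u assume "u \<in> sum_scaled I y J"
  then obtain m n where "m \<in> I" "n \<in> J" "u = m \<oplus> y \<otimes> n" by (rule sum_scaledE)
  then show "u \<in> D" using yJ ideal_subset[OF I] by simp
next
  have "\<zero> = \<zero> \<oplus> y \<otimes> \<zero>" using y by simp
  then show "\<zero> \<in> sum_scaled I y J"
    using sum_scaledI[OF ideal_zero[OF I] ideal_zero[OF J]] by metis
next
  fix u v assume "u \<in> sum_scaled I y J" "v \<in> sum_scaled I y J"
  then obtain m n m' n' where mn: "m \<in> I" "n \<in> J" "u = m \<oplus> y \<otimes> n"
    "m' \<in> I" "n' \<in> J" "v = m' \<oplus> y \<otimes> n'" by (auto elim!: sum_scaledE)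
  then have "m \<in> carrier K" "n \<in> carrier K" "m' \<in> carrier K" "n' \<in> carrier K"
    using ideal_subset[OF I] ideal_subset[OF J] by auto
  then have "u \<oplus> v = (m \<oplus> m') \<oplus> y \<otimes> (n \<oplus> n')"
    unfolding mn(3,6) using y by algebra
  then show "u \<oplus> v \<in> sum_scaled I y J"
    using sum_scaledI[OF ideal_add[OF I mn(1,4)] ideal_add[OF J mn(2,5)]] by simp
next
  fix d u assume d: "d \<in> D" and "u \<in> sum_scaled I y J"
  then obtain m n where mn: "m \<in> I" "n \<in> J" "u = m \<oplus> y \<otimes> n" by (blast elim: sum_scaledE)
  then have "m \<in> carrier K" "n \<in> carrier K" "d \<in> carrier K"
    using ideal_subset[OF I] ideal_subset[OF J] d by auto
  then have "d \<otimes> u = d \<otimes> m \<oplus> y \<otimes> (d \<otimes> n)"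
    unfolding mn(3) using y by algebra
  then show "d \<otimes> u \<in> sum_scaled I y J"
    using sum_scaledI[OF ideal_mult[OF I d mn(1)] ideal_mult[OF J d mn(2)]] by simp
qed

lemma sum_scaled_left:
  assumes I: "ideal I R" and J: "ideal J R" and y: "y \<in> carrier K"
  shows "I \<subseteq> sum_scaled I y J"
proof
  fix m assume m: "m \<in> I"
  then have "m = m \<oplus> y \<otimes> \<zero>" using ideal_subset[OF I] y by simp
  then show "m \<in> sum_scaled I y J"
    using sum_scaledI[OF m ideal_zero[OF J]] by metis
qed

lemma sum_scaled_right:
  assumes I: "ideal I R" and J: "ideal J R" and y: "y \<in> carrier K" and n: "n \<in> J"
  shows "y \<otimes> n \<in> sum_scaled I y J"
proof -
  have "y \<otimes> n = \<zero> \<oplus> y \<otimes> n" using n ideal_subset[OF J] y by simp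
  then show ?thesis
    using sum_scaledI[OF ideal_zero[OF I] n] by metis
qed

section \<open>Prime ideals of \<open>D\<close>\<close>

lemma primeideal_R_iff:
  "primeideal P R \<longleftrightarrow> ideal P R \<and> \<one> \<notin> P \<and>
    (\<forall>x\<in>D. \<forall>y\<in>D. x \<otimes> y \<in> P \<longrightarrow> x \<in> P \<or> y \<in> P)"
proof
  assume P: "primeideal P R"
  have I: "ideal P R" using P by (rule primeideal.axioms(1))
  show "ideal P R \<and> \<one> \<notin> P \<and> (\<forall>x\<in>D. \<forall>y\<in>D. x \<otimes> y \<in> P \<longrightarrow> x \<in> P \<or> y \<in> P)"
    using I primeideal.I_notcarr[OF P] primeideal.I_prime[OF P] ideal_eq_carrier[OF I] by auto
next
  assume "ideal P R \<and> \<one> \<notin> P \<and> (\<forall>x\<in>D. \<forall>y\<in>D. x \<otimes> y \<in> P \<longrightarrow> x \<in> P \<or> y \<in> P)"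
  then show "primeideal P R"
    by (intro primeidealI D.is_cring) auto
qed

text \<open>Here the dimension condition on a Dedekind domain enters; properness is expressed by
  \<open>\<one> \<notin> J\<close>.\<close>

lemma prime_maximal:
  assumes "primeideal P R" "P \<noteq> {\<zero>}" "ideal J R" "P \<subseteq> J" "\<one> \<notin> J"
  shows "J = P"
proof -
  have "maximalideal P R"
    using dedekind assms(1,2) by (simp add: dedekind_domain_def)
  moreover have "J \<subseteq> D" using ideal_subset[OF assms(3)] by blast
  ultimately have "J = P \<or> J = D"
    using maximalideal.I_maximal[of P R J] assms(3,4) by simp
  then show ?thesis using assms(5) by auto
qed

text \<open>An ideal \<open>Q\<close> maximal among those containing \<open>I\<close> but not 1 is
  prime: if \<open>v \<notin> Q\<close>, then \<open>1 = m + v d\<close> with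
  \<open>m \<in> Q\<close>, and multiplying by \<open>u\<close> puts \<open>u\<close> into
  \<open>Q\<close> whenever \<open>u v \<in> Q\<close>.\<close>

lemma exists_prime_above:
  assumes "ideal I R" "\<one> \<notin> I"
  shows "\<exists>Q. primeideal Q R \<and> I \<subseteq> Q"
proof -
  let ?F = "{J. ideal J R \<and> I \<subseteq> J \<and> \<one> \<notin> J}"
  have "\<exists>M\<in>?F. \<forall>J\<in>?F. M \<subseteq> J \<longrightarrow> J = M"
    by (rule D.exists_maximal_in_family) (use assms in auto)
  then obtain Q where Q: "ideal Q R" "I \<subseteq> Q" "\<one> \<notin> Q"
    and max: "\<And>J. ideal J R \<Longrightarrow> Q \<subseteq> J \<Longrightarrow> \<one> \<notin> J \<Longrightarrow> J = Q"
    by auto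
  have "u \<in> Q \<or> v \<in> Q" if uv: "u \<in> D" "v \<in> D" "u \<otimes> v \<in> Q" for u v
  proof (rule disjCI)
    assume "v \<notin> Q"
    let ?J = "sum_scaled Q v D"
    have J: "ideal ?J R" using uv Q ideal_carrier by (intro ideal_sum_scaled) auto
    have "v \<in> ?J" using sum_scaled_right[OF Q(1) ideal_carrier, of v \<one>] uv by simp
    then have "\<one> \<in> ?J"
      using max[OF J sum_scaled_left[OF Q(1) ideal_carrier]] \<open>v \<notin> Q\<close> uv by auto
    then obtain m d where md: "m \<in> Q" "d \<in> D" "\<one> = m \<oplus> v \<otimes> d" by (rule sum_scaledE)
    have c: "m \<in> carrier K" "d \<in> carrier K" "u \<in> carrier K" "v \<in> carrier K"
      using md uv ideal_subset[OF Q(1)] by auto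
    then have "u = u \<otimes> (m \<oplus> v \<otimes> d)" using md(3)[symmetric] by simp
    also have "\<dots> = u \<otimes> m \<oplus> d \<otimes> (u \<otimes> v)" using c by algebra
    finally show "u \<in> Q"
      using ideal_add[OF Q(1) ideal_mult[OF Q(1) uv(1) md(1)] ideal_mult[OF Q(1) md(2) uv(3)]]
      by simp
  qed
  then have "primeideal Q R" using Q by (simp add: primeideal_R_iff)
  then show ?thesis using Q(2) by blast
qed

section \<open>Invertibility of nonzero primes\<close>

text \<open>The colon ideals \<open>(x : z)\<close> with \<open>0 \<noteq> x \<in> P\<close> contained in \<open>P\<close> have a maximal
  member, which is prime and hence equals \<open>P\<close>; the witness is then \<open>z / x\<close>.\<close>

lemma prime_has_denominator:
  assumes P: "primeideal P R" "P \<noteq> {\<zero>}"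
  shows "\<exists>y\<in>carrier K. y \<notin> D \<and> (\<forall>m\<in>P. y \<otimes> m \<in> D)"
proof -
  have PI: "ideal P R" and P1: "\<one> \<notin> P"
    and Pp: "\<And>x y. x \<in> D \<Longrightarrow> y \<in> D \<Longrightarrow> x \<otimes> y \<in> P \<Longrightarrow> x \<in> P \<or> y \<in> P"
    using P(1) by (auto simp: primeideal_R_iff)
  obtain x where x: "x \<in> P" "x \<noteq> \<zero>" using P(2) ideal_zero[OF PI] by blast
  have xD: "x \<in> D" using ideal_subset[OF PI x(1)] .
  define col where "col z = {d \<in> D. \<exists>e\<in>D. d \<otimes> z = x \<otimes> e}" for z
  have colI: "ideal (col z) R" if z: "z \<in> D" for z
    unfolding ideal_R_iff
  proof (intro conjI ballI)
    show "col z \<subseteq> D" "\<zero> \<in> col z" unfolding col_def using z xD by (auto intro: bexI[of _ \<zero>])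
  next
    fix u v assume "u \<in> col z" "v \<in> col z"
    then obtain e e' where e: "u \<in> D" "v \<in> D" "e \<in> D" "e' \<in> D"
      "u \<otimes> z = x \<otimes> e" "v \<otimes> z = x \<otimes> e'" unfolding col_def by auto
    then have "(u \<oplus> v) \<otimes> z = x \<otimes> (e \<oplus> e')" using z xD by (simp add: l_distr r_distr)
    then show "u \<oplus> v \<in> col z" unfolding col_def using e by (auto intro: bexI[of _ "e \<oplus> e'"])
  next
    fix d u assume d: "d \<in> D" and "u \<in> col z"
    then obtain e where e: "u \<in> D" "e \<in> D" "u \<otimes> z = x \<otimes> e" unfolding col_def by auto
    then have "(d \<otimes> u) \<otimes> z = d \<otimes> (x \<otimes> e)" using z xD d by (simp add: m_assoc)
    also have "\<dots> = x \<otimes> (d \<otimes> e)" using e xD d by (simp add: m_lcomm)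
    finally show "d \<otimes> u \<in> col z" unfolding col_def using e d by (auto intro: bexI[of _ "d \<otimes> e"])
  qed
  have col_mono: "col z \<subseteq> col (w \<otimes> z)" if "z \<in> D" "w \<in> D" for z w
  proof
    fix u assume "u \<in> col z"
    then obtain e where e: "u \<in> D" "e \<in> D" "u \<otimes> z = x \<otimes> e" unfolding col_def by auto
    have "u \<otimes> (w \<otimes> z) = w \<otimes> (u \<otimes> z)" using e(1) that by (simp add: m_lcomm)
    also have "\<dots> = x \<otimes> (w \<otimes> e)" unfolding e(3) using e(2) xD that by (simp add: m_lcomm)
    finally show "u \<in> col (w \<otimes> z)" unfolding col_def using e that by (auto intro: bexI[of _ "w \<otimes> e"])
  qed
  let ?F = "{col z | z. z \<in> D \<and> col z \<subseteq> P}"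
  \<comment> \<open>The colon ideal of 1 is \<open>x D\<close>, contained in \<open>P\<close>, so
    the family is nonempty.\<close>
  have "d \<in> P" if "d \<in> col \<one>" for d
    using that ideal_mult[OF PI _ x(1)] xD unfolding col_def by (auto simp: m_comm)
  then have "?F \<noteq> {}" using D_one by blast
  then have "\<exists>M\<in>?F. \<forall>J\<in>?F. M \<subseteq> J \<longrightarrow> J = M"
    by (rule D.exists_maximal_in_family) (use colI in auto)
  then obtain M where "M \<in> ?F" and M: "\<forall>J\<in>?F. M \<subseteq> J \<longrightarrow> J = M" by (rule bexE)
  then obtain z where z: "z \<in> D" "col z \<subseteq> P" "M = col z" by blast
  have max: "col w = col z" if "w \<in> D" "col w \<subseteq> P" "col z \<subseteq> col w" for w
  proof -
    have "col w \<in> ?F" using that by blast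
    then show ?thesis using M that(3) z(3) by blast
  qed
  \<comment> \<open>As \<open>v\<close> lies in \<open>col (w \<otimes> z)\<close> but not in
    \<open>col z\<close>, maximality forces the larger ideal to leave \<open>P\<close>;
    \<open>s\<close> is an element of it outside \<open>P\<close>.\<close>
  have grow: "\<exists>s\<in>D. s \<notin> P \<and> s \<otimes> w \<in> col z"
    if w: "w \<in> D" "v \<in> D" "v \<notin> col z" "v \<otimes> w \<in> col z" for v w
  proof -
    have "v \<in> col (w \<otimes> z)" using w z(1) unfolding col_def by (auto simp: m_assoc)
    then have "col (w \<otimes> z) \<noteq> col z" using w(3) by blast
    then have "\<not> col (w \<otimes> z) \<subseteq> P" using max[of "w \<otimes> z"] col_mono[OF z(1) w(1)] w z by auto
    then obtain s where "s \<in> col (w \<otimes> z)" "s \<notin> P" by blast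
    moreover from this have "s \<otimes> w \<in> col z" "s \<in> D"
      using w(1) z(1) unfolding col_def by (auto simp: m_assoc)
    ultimately show ?thesis by blast
  qed
  have "primeideal (col z) R"
    unfolding primeideal_R_iff
  proof (intro conjI ballI impI)
    show "ideal (col z) R" using colI z by simp
    show "\<one> \<notin> col z" using z P1 by blast
    fix u v assume uv: "u \<in> D" "v \<in> D" "u \<otimes> v \<in> col z"
    show "u \<in> col z \<or> v \<in> col z"
    proof (rule ccontr)
      \<comment> \<open>Two uses of \<open>grow\<close> exchange both factors: \<open>u v\<close>
        for \<open>s v\<close>, then \<open>v s\<close> for \<open>t s\<close>. Now \<open>s\<close>
        and \<open>t\<close> lie outside the prime \<open>P\<close>, although
        \<open>t s \<in> col z \<subseteq> P\<close>.\<close>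
      assume n: "\<not> (u \<in> col z \<or> v \<in> col z)"
      then obtain s where s: "s \<in> D" "s \<notin> P" "s \<otimes> v \<in> col z" using grow[of v u] uv by blast
      then have "v \<otimes> s \<in> col z" using uv by (simp add: m_comm)
      then obtain t where t: "t \<in> D" "t \<notin> P" "t \<otimes> s \<in> col z" using grow[of s v] uv s n by blast
      then show False using Pp[of t s] s z(2) by blast
    qed
  qed
  moreover have "x \<in> col z" unfolding col_def using xD z by auto
  then have "col z \<noteq> {\<zero>}" using x by blast
  ultimately have "P = col z" using prime_maximal[OF _ _ PI z(2) P1] by blast
  define y where "y = inv x \<otimes> z"
  have ix: "inv x \<in> carrier K" "inv x \<otimes> x = \<one>" using x(2) xD by (auto simp: field_Units)
  have xy: "x \<otimes> y = z" unfolding y_def using ix xD z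
    by (metis D_carrier l_one m_assoc m_comm)
  have "y \<in> carrier K" unfolding y_def using ix z by simp
  moreover have "y \<notin> D"
  proof
    assume "y \<in> D"
    then have "\<one> \<in> col z" unfolding col_def using xy z by (auto intro!: bexI[of _ y])
    then show False using z P1 by blast
  qed
  moreover have "y \<otimes> m \<in> D" if "m \<in> P" for m
  proof -
    have "m \<in> col z" using that \<open>P = col z\<close> by simp
    then obtain e where e: "m \<in> D" "e \<in> D" "m \<otimes> z = x \<otimes> e" unfolding col_def by auto
    have "y \<otimes> m = inv x \<otimes> (m \<otimes> z)" unfolding y_def using e(1) z ix by (simp add: m_ac)
    also have "\<dots> = e" unfolding e(3) using e xD ix by (simp add: m_assoc[symmetric])
    finally show ?thesis using e by simp
  qed
  ultimately show ?thesis by blast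
qed

text \<open>Take \<open>y\<close> outside \<open>D\<close> with \<open>y P \<subseteq> D\<close>.
  Were \<open>P + y P\<close> proper, it would be \<open>P\<close> itself, so \<open>y\<close> would
  map \<open>P\<close> into \<open>P\<close> and be integral, hence in \<open>D\<close>. The
  equation says that \<open>P\<close> times the fractional ideal \<open>D + y D\<close> is
  \<open>D\<close>.\<close>

lemma prime_invertible:
  assumes P: "primeideal P R" "P \<noteq> {\<zero>}"
  shows "\<exists>y\<in>carrier K. \<exists>p\<in>P. \<exists>q\<in>P. (\<forall>m\<in>P. y \<otimes> m \<in> D) \<and> \<one> = p \<oplus> y \<otimes> q"
proof -
  have PI: "ideal P R" using P(1) by (simp add: primeideal_R_iff)
  obtain x where x: "x \<in> P" "x \<noteq> \<zero>" using P(2) ideal_zero[OF PI] by blast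
  obtain y where y: "y \<in> carrier K" "y \<notin> D" "\<And>m. m \<in> P \<Longrightarrow> y \<otimes> m \<in> D"
    using prime_has_denominator[OF P] by blast
  let ?S = "sum_scaled P y P"
  have S: "ideal ?S R" by (rule ideal_sum_scaled[OF PI PI y(1,3)])
  have "\<one> \<in> ?S"
  proof (rule ccontr)
    assume "\<one> \<notin> ?S"
    then have "?S = P" by (rule prime_maximal[OF P S sum_scaled_left[OF PI PI y(1)]])
    then have "y \<in> D"
      using integral_multiplier_mem[OF PI x y(1)] sum_scaled_right[OF PI PI y(1)] by simp
    then show False using y(2) by simp
  qed
  then show ?thesis using y by (auto elim!: sum_scaledE)
qed

section \<open>Approximation and a local generator of a prime\<close>

text \<open>Noetherian induction on \<open>N\<close> replaces the finiteness of the set of primes above \<open>N\<close>.\<close>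

lemma exists_separating_element:
  assumes P: "primeideal P R" "P \<noteq> {\<zero>}" and N: "ideal N R" "N \<noteq> {\<zero>}"
  shows "\<exists>t\<in>D. \<one> \<ominus> t \<in> P \<and> (\<forall>Q. primeideal Q R \<and> N \<subseteq> Q \<and> Q \<noteq> P \<longrightarrow> t \<in> Q)"
    (is "?sep N")
proof (rule ccontr)
  assume not_sep: "\<not> ?sep N"
  have PI: "ideal P R" and P1: "\<one> \<notin> P"
    using P(1) by (auto simp: primeideal_R_iff)
  let ?F = "{N. ideal N R \<and> N \<noteq> {\<zero>} \<and> \<not> ?sep N}"
  have "N \<in> ?F" using N not_sep by blast
  then have "?F \<noteq> {}" by blast
  then have "\<exists>M\<in>?F. \<forall>J\<in>?F. M \<subseteq> J \<longrightarrow> J = M"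
    by (rule D.exists_maximal_in_family) blast
  then obtain M where M: "ideal M R" "M \<noteq> {\<zero>}" and nM: "\<not> ?sep M"
    and max: "\<forall>J\<in>?F. M \<subseteq> J \<longrightarrow> J = M" by blast
  \<comment> \<open>Otherwise \<open>t = 1\<close> separates, there being no prime \<open>Q\<close>
    to test.\<close>
  have other_prime: "\<exists>Q. primeideal Q R \<and> M \<subseteq> Q \<and> Q \<noteq> P"
  proof (rule ccontr)
    assume "\<nexists>Q. primeideal Q R \<and> M \<subseteq> Q \<and> Q \<noteq> P"
    moreover have "\<one> \<ominus> \<one> \<in> P" using ideal_zero[OF PI] by (simp add: a_minus_def r_neg)
    ultimately show False using nM D_one by blast
  qed
  show False
  proof (cases "primeideal M R")
    case True
    then have M1: "\<one> \<notin> M" by (simp add: primeideal_R_iff)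
    \<comment> \<open>For prime \<open>M\<close> any \<open>t \<in> M\<close> with
      \<open>1 - t \<in> P\<close> will do. It exists because \<open>M\<close> and \<open>P\<close>
      are distinct maximal ideals; \<open>M = P\<close> contradicts \<open>other_prime\<close>, as
      no other prime lies above \<open>P\<close>.\<close>
    have "M \<noteq> P"
    proof
      assume "M = P"
      then show False using other_prime prime_maximal[OF P] by (metis primeideal_R_iff)
    qed
    then have "\<not> M \<subseteq> P" using prime_maximal[OF True M(2) PI _ P1] by blast
    then obtain n where n: "n \<in> M" "n \<notin> P" by blast
    have nD: "n \<in> D" using ideal_subset[OF M(1) n(1)] .
    let ?S = "sum_scaled P n D"
    have S: "ideal ?S R" using nD PI ideal_carrier by (intro ideal_sum_scaled) auto
    have "n \<in> ?S" using sum_scaled_right[OF PI ideal_carrier, of n \<one>] nD by simp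
    then have "\<one> \<in> ?S"
      using prime_maximal[OF P S sum_scaled_left[OF PI ideal_carrier]] n nD by auto
    then obtain p d where pd: "p \<in> P" "d \<in> D" "\<one> = p \<oplus> n \<otimes> d" by (rule sum_scaledE)
    have c: "p \<in> carrier K" "n \<in> carrier K" "d \<in> carrier K"
      using pd nD ideal_subset[OF PI] by auto
    have "\<one> \<ominus> n \<otimes> d = p" unfolding pd(3) using c by algebra
    moreover have "n \<otimes> d \<in> M" using ideal_mult[OF M(1) pd(2) n(1)] c by (simp add: m_comm)
    ultimately have "?sep M" using pd(1) nD pd(2) by (intro bexI[of _ "n \<otimes> d"]) auto
    then show False using nM by contradiction
  next
    case False
    have "\<one> \<notin> M"
      using other_prime by (metis primeideal_R_iff subsetD)
    then obtain u v where uv: "u \<in> D" "v \<in> D" "u \<otimes> v \<in> M" "u \<notin> M" "v \<notin> M"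
      using False M(1) by (auto simp: primeideal_R_iff)
    \<comment> \<open>By maximality of \<open>M\<close>, the strictly larger ideals
      \<open>M + u D\<close> and \<open>M + v D\<close> have separating elements. Every prime above
      \<open>M\<close> contains \<open>u\<close> or \<open>v\<close>, so the product of these two
      elements separates for \<open>M\<close>.\<close>
    have larger: "?sep (sum_scaled M w D)" if w: "w \<in> D" "w \<notin> M" for w
    proof (rule ccontr)
      assume ns: "\<not> ?sep (sum_scaled M w D)"
      let ?S = "sum_scaled M w D"
      have S: "ideal ?S R" using w M ideal_carrier by (intro ideal_sum_scaled) auto
      have sub: "M \<subseteq> ?S" using sum_scaled_left[OF M(1) ideal_carrier] w by simp
      have "w \<in> ?S" using sum_scaled_right[OF M(1) ideal_carrier, of w \<one>] w by simp
      moreover have "?S \<noteq> {\<zero>}" using sub M ideal_zero[OF M(1)] by blast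
      then have "?S = M" using max S sub ns by blast
      ultimately show False using w by simp
    qed
    obtain t1 where t1: "t1 \<in> D" "\<one> \<ominus> t1 \<in> P"
      "\<And>Q. primeideal Q R \<Longrightarrow> sum_scaled M u D \<subseteq> Q \<Longrightarrow> Q \<noteq> P \<Longrightarrow> t1 \<in> Q"
      using larger[OF uv(1,4)] by blast
    obtain t2 where t2: "t2 \<in> D" "\<one> \<ominus> t2 \<in> P"
      "\<And>Q. primeideal Q R \<Longrightarrow> sum_scaled M v D \<subseteq> Q \<Longrightarrow> Q \<noteq> P \<Longrightarrow> t2 \<in> Q"
      using larger[OF uv(2,5)] by blast
    have c: "t1 \<in> carrier K" "t2 \<in> carrier K" using t1 t2 by auto
    have "\<one> \<ominus> t1 \<otimes> t2 = (\<one> \<ominus> t1) \<oplus> t1 \<otimes> (\<one> \<ominus> t2)" using c by algebra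
    then have "\<one> \<ominus> t1 \<otimes> t2 \<in> P"
      using ideal_add[OF PI t1(2) ideal_mult[OF PI t1(1) t2(2)]] by simp
    moreover have "t1 \<otimes> t2 \<in> Q" if Q: "primeideal Q R" "M \<subseteq> Q" "Q \<noteq> P" for Q
    proof -
      have QI: "ideal Q R" using Q(1) by (simp add: primeideal_R_iff)
      have sub: "sum_scaled M w D \<subseteq> Q" if "w \<in> Q" for w
        using that Q(2) ideal_subset[OF QI] ideal_add[OF QI] ideal_mult[OF QI]
        by (fastforce elim!: sum_scaledE simp: m_comm)
      have "u \<in> Q \<or> v \<in> Q" using Q uv by (auto simp: primeideal_R_iff)
      then have "t1 \<in> Q \<or> t2 \<in> Q" using sub t1(3)[OF Q(1)] t2(3)[OF Q(1)] Q(3) by blast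
      then show ?thesis
        using ideal_mult[OF QI t1(1), of t2] ideal_mult[OF QI t2(1), of t1] c by (auto simp: m_comm)
    qed
    ultimately have "?sep M" using t1(1) t2(1) by (intro bexI[of _ "t1 \<otimes> t2"]) auto
    then show False using nM by contradiction
  qed
qed

text \<open>Here \<open>b\<close> has order exactly one at \<open>P\<close> and lies in no other prime containing \<open>c\<close>, so that
  no prime contains \<open>b (D + y D) + c P\<close>.\<close>

lemma prime_locally_generated:
  assumes P: "primeideal P R" "P \<noteq> {\<zero>}" and c: "c \<in> D" "c \<noteq> \<zero>"
  shows "\<exists>r\<in>P. \<exists>b\<in>P. \<forall>m\<in>P. \<exists>d\<in>D. (\<one> \<ominus> c \<otimes> r) \<otimes> m = b \<otimes> d"
proof -
  have PI: "ideal P R" and P1: "\<one> \<notin> P"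
    and Pp: "\<And>x y. x \<in> D \<Longrightarrow> y \<in> D \<Longrightarrow> x \<otimes> y \<in> P \<Longrightarrow> x \<in> P \<or> y \<in> P"
    using P(1) by (auto simp: primeideal_R_iff)
  have PK: "x \<in> carrier K" if "x \<in> P" for x using ideal_subset[OF PI that] by simp
  \<comment> \<open>\<open>D + y D\<close> lies in the inverse of \<open>P\<close>, and
    \<open>y q\<close> is 1 modulo \<open>P\<close>.\<close>
  obtain y p q where y: "y \<in> carrier K" "\<And>m. m \<in> P \<Longrightarrow> y \<otimes> m \<in> D"
    and pq: "p \<in> P" "q \<in> P" "\<one> = p \<oplus> y \<otimes> q"
    using prime_invertible[OF P] by blast
  have zI: "ideal {\<zero>} R" by (auto simp: ideal_R_iff)
  define N where "N = sum_scaled {\<zero>} c D"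
  have NI: "ideal N R" unfolding N_def using zI ideal_carrier c by (intro ideal_sum_scaled) auto
  have "c \<in> N" unfolding N_def
    using sum_scaled_right[OF zI ideal_carrier, of c \<one>] c by simp
  then have "N \<noteq> {\<zero>}" using c by blast
  then obtain t where t: "t \<in> D" "\<one> \<ominus> t \<in> P"
    and tQ: "\<And>Q. primeideal Q R \<Longrightarrow> N \<subseteq> Q \<Longrightarrow> Q \<noteq> P \<Longrightarrow> t \<in> Q"
    using exists_separating_element[OF P NI] by blast
  define u where "u = \<one> \<ominus> t"
  have tK: "t \<in> carrier K" using t by simp
  have u: "u \<in> P" "u \<in> D" using t unfolding u_def by auto
  have tu: "\<one> = t \<oplus> u" unfolding u_def using tK by algebra
  \<comment> \<open>\<open>b\<close> is glued from \<open>q\<close> at \<open>P\<close> and 1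
    elsewhere: modulo \<open>P^2\<close> it is congruent to \<open>q\<close>, as \<open>t\<close> is
    1 modulo \<open>P\<close> and \<open>u \<in> P\<close>; modulo any other prime containing
    \<open>c\<close>, \<open>t\<close> vanishes and \<open>u\<close> is 1.\<close>
  define b where "b = t \<otimes> q \<oplus> u \<otimes> u"
  have b: "b \<in> P" unfolding b_def
    using ideal_add[OF PI ideal_mult[OF PI t(1) pq(2)] ideal_mult[OF PI u(2,1)]] .
  have bD: "b \<in> D" using ideal_subset[OF PI b] .
  have byD: "b \<otimes> y \<in> D" using y(2)[OF b] y(1) bD by (simp add: m_comm)
  \<comment> \<open>\<open>B\<close> is \<open>b (D + y D)\<close> and \<open>J\<close> is
    \<open>B + c P\<close>. Once \<open>\<one> \<in> J\<close>, some \<open>1 - c r\<close> lies in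
    \<open>B\<close>, and multiplying it by elements of \<open>P\<close> lands in
    \<open>b D\<close>.\<close>
  define B where "B = sum_scaled (sum_scaled {\<zero>} b D) (b \<otimes> y) D"
  define J where "J = sum_scaled B c P"
  have B0: "ideal (sum_scaled {\<zero>} b D) R"
    using zI ideal_carrier bD by (intro ideal_sum_scaled) auto
  have BI: "ideal B R" unfolding B_def
    by (rule ideal_sum_scaled[OF B0 ideal_carrier]) (use byD in auto)
  have JI: "ideal J R" unfolding J_def
    by (rule ideal_sum_scaled[OF BI PI]) (use c ideal_subset[OF PI] in auto)
  have BJ: "B \<subseteq> J" unfolding J_def using sum_scaled_left[OF BI PI] c by simp
  have "b \<in> sum_scaled {\<zero>} b D"
    using sum_scaled_right[OF zI ideal_carrier, of b \<one>] bD by simp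
  then have bB: "b \<in> B" unfolding B_def
    using sum_scaled_left[OF B0 ideal_carrier, of "b \<otimes> y"] byD by auto
  have byB: "b \<otimes> y \<in> B" unfolding B_def
    using sum_scaled_right[OF B0 ideal_carrier, of "b \<otimes> y" \<one>] byD by simp
  have "\<one> \<in> J"
  proof (rule ccontr)
    assume "\<one> \<notin> J"
    then obtain Q where Q: "primeideal Q R" "J \<subseteq> Q" using exists_prime_above[OF JI] by blast
    have QI: "ideal Q R" and Q1: "\<one> \<notin> Q"
      and Qp: "\<And>x y. x \<in> D \<Longrightarrow> y \<in> D \<Longrightarrow> x \<otimes> y \<in> Q \<Longrightarrow> x \<in> Q \<or> y \<in> Q"
      using Q(1) by (auto simp: primeideal_R_iff)
    have cr: "c \<otimes> r \<in> Q" if "r \<in> P" for r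
      using sum_scaled_right[OF BI PI _ that, of c] c Q(2) unfolding J_def by auto
    show False
    proof (cases "Q = P")
      case True
      \<comment> \<open>Removing the \<open>u\<close>-term from \<open>b y\<close> leaves
        \<open>t (y q)\<close>, yet \<open>t\<close> and \<open>y q\<close> are both 1 modulo
        \<open>P\<close>.\<close>
      have "b \<otimes> y \<in> P" using byB BJ Q(2) True by blast
      moreover have "u \<otimes> ((\<ominus> \<one>) \<otimes> (y \<otimes> u)) \<in> P"
        using ideal_mult[OF PI _ u(1), of "(\<ominus> \<one>) \<otimes> (y \<otimes> u)"] y(2)[OF u(1)] u(2)
        by (simp add: m_comm)
      ultimately have "b \<otimes> y \<oplus> u \<otimes> ((\<ominus> \<one>) \<otimes> (y \<otimes> u)) \<in> P" by (rule ideal_add[OF PI])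
      moreover have "b \<otimes> y \<oplus> u \<otimes> ((\<ominus> \<one>) \<otimes> (y \<otimes> u)) = t \<otimes> (y \<otimes> q)"
      proof -
        have "t \<in> carrier K" "q \<in> carrier K" "u \<in> carrier K" using t u PK pq by auto
        then show ?thesis unfolding b_def using y(1) by algebra
      qed
      ultimately have "t \<in> P \<or> y \<otimes> q \<in> P" using Pp t y(2)[OF pq(2)] by simp
      then show False
      proof
        assume "t \<in> P"
        then have "t \<oplus> u \<in> P" by (rule ideal_add[OF PI _ u(1)])
        then show False using tu P1 by simp
      next
        assume "y \<otimes> q \<in> P"
        then have "p \<oplus> y \<otimes> q \<in> P" by (rule ideal_add[OF PI pq(1)])
        then show False using pq(3) P1 by simp
      qed
    next
      case False
      \<comment> \<open>\<open>c P \<subseteq> Q\<close> with \<open>P\<close> not inside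
        \<open>Q\<close> forces \<open>c \<in> Q\<close>, so \<open>t \<in> Q\<close>. Then
        \<open>u^2 = b - q t\<close> lies in \<open>Q\<close>, contradicting
        \<open>1 = t + u\<close>.\<close>
      have "c \<in> Q"
      proof (rule ccontr)
        assume "c \<notin> Q"
        then have "P \<subseteq> Q" using cr Qp c ideal_subset[OF PI] by blast
        then show False using prime_maximal[OF P QI _ Q1] False by blast
      qed
      then have "N \<subseteq> Q" unfolding N_def
        using ideal_mult[OF QI] c by (auto elim!: sum_scaledE simp: m_comm)
      then have "t \<in> Q" using tQ Q(1) False by blast
      moreover have "b \<in> Q" using bB BJ Q(2) by blast
      ultimately have "b \<ominus> q \<otimes> t \<in> Q"
        using ideal_diff[OF QI _ ideal_mult[OF QI ideal_subset[OF PI pq(2)]]] by blast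
      moreover have "b \<ominus> q \<otimes> t = u \<otimes> u"
      proof -
        have "t \<in> carrier K" "q \<in> carrier K" "u \<in> carrier K" using t u PK pq by auto
        then show ?thesis unfolding b_def by algebra
      qed
      ultimately have "u \<in> Q" using Qp u by auto
      then have "t \<oplus> u \<in> Q" using \<open>t \<in> Q\<close> ideal_add[OF QI] by blast
      then show False using tu Q1 by simp
    qed
  qed
  then obtain k r where "k \<in> B" and r: "r \<in> P" and kr: "\<one> = k \<oplus> c \<otimes> r"
    unfolding J_def by (rule sum_scaledE)
  then obtain d e where de: "d \<in> D" "e \<in> D" "k = (\<zero> \<oplus> b \<otimes> d) \<oplus> b \<otimes> y \<otimes> e"
    unfolding B_def by (auto elim!: sum_scaledE)
  have "\<exists>d\<in>D. (\<one> \<ominus> c \<otimes> r) \<otimes> m = b \<otimes> d" if m: "m \<in> P" for m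
  proof (rule bexI)
    have K: "m \<in> carrier K" "r \<in> carrier K" "b \<in> carrier K" "c \<in> carrier K"
      "d \<in> carrier K" "e \<in> carrier K"
      using PK m r b c de by auto
    have "\<one> \<ominus> c \<otimes> r = b \<otimes> d \<oplus> b \<otimes> y \<otimes> e"
      unfolding kr de(3) using K y(1) by algebra
    then have "(\<one> \<ominus> c \<otimes> r) \<otimes> m = (b \<otimes> d \<oplus> b \<otimes> y \<otimes> e) \<otimes> m" by simp
    also have "\<dots> = b \<otimes> (d \<otimes> m \<oplus> e \<otimes> (y \<otimes> m))" using K y(1) by algebra
    finally show "(\<one> \<ominus> c \<otimes> r) \<otimes> m = b \<otimes> (d \<otimes> m \<oplus> e \<otimes> (y \<otimes> m))" .
    show "d \<otimes> m \<oplus> e \<otimes> (y \<otimes> m) \<in> D"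
      using de y(2)[OF m] ideal_subset[OF PI m] by simp
  qed
  then show ?thesis using r b by blast
qed

section \<open>From principal primes to principal ideals\<close>

text \<open>Let \<open>M\<close> be maximal among the nonprincipal ideals and \<open>P = g D\<close>
  a prime above it. The ideal \<open>J = (M : g)\<close> contains \<open>M\<close> and satisfies
  \<open>M = g J\<close>. If \<open>J\<close> is larger than \<open>M\<close>, it is principal and
  so is \<open>M\<close>; if \<open>J = M\<close>, then the inverse of \<open>g\<close> maps
  \<open>M\<close> into itself, hence lies in \<open>D\<close>, so that
  \<open>\<one> \<in> P\<close>.\<close>

lemma principal_domain_if_primes_principal:
  assumes primes: "\<And>P. primeideal P R \<Longrightarrow> P \<noteq> {\<zero>} \<Longrightarrow> \<exists>g\<in>D. P = PIdl\<^bsub>R\<^esub> g"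
  shows "principal_domain R"
proof (intro principal_domain.intro principal_domain_axioms.intro)
  show "domain R" by (rule D.domain_axioms)
  fix I assume I: "ideal I R"
  show "\<exists>a\<in>carrier R. I = PIdl\<^bsub>R\<^esub> a"
  proof (rule ccontr)
    let ?F = "{I. ideal I R \<and> \<not> (\<exists>a\<in>D. I = PIdl\<^bsub>R\<^esub> a)}"
    assume "\<not> ?thesis"
    then have "I \<in> ?F" using I by simp
    then have "?F \<noteq> {}" by blast
    then have "\<exists>M\<in>?F. \<forall>J\<in>?F. M \<subseteq> J \<longrightarrow> J = M"
      by (rule D.exists_maximal_in_family) blast
    then obtain M where M: "ideal M R" and np: "\<And>a. a \<in> D \<Longrightarrow> M \<noteq> PIdl\<^bsub>R\<^esub> a"
      and max: "\<forall>J\<in>?F. M \<subseteq> J \<longrightarrow> J = M" by blast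
    have "PIdl\<^bsub>R\<^esub> \<one> = D" by (force simp: cgenideal_def)
    moreover have PIdl_zero: "PIdl\<^bsub>R\<^esub> \<zero> = {\<zero>}"
      by (auto simp: cgenideal_def intro!: exI[of _ \<zero>])
    ultimately have "M \<noteq> D" and M0: "M \<noteq> {\<zero>}" using np[of \<one>] np[of \<zero>] by auto
    then have "\<one> \<notin> M" using ideal_eq_carrier[OF M] by blast
    then obtain P where P: "primeideal P R" "M \<subseteq> P" using exists_prime_above[OF M] by blast
    have PI: "ideal P R" and P1: "\<one> \<notin> P" using P(1) by (auto simp: primeideal_R_iff)
    obtain x where x: "x \<in> M" "x \<noteq> \<zero>" using M0 ideal_zero[OF M] by blast
    then have "P \<noteq> {\<zero>}" using P(2) by blast
    then obtain g where g: "g \<in> D" "P = PIdl\<^bsub>R\<^esub> g" using primes P(1) by blast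
    have g0: "g \<noteq> \<zero>" using g(2) \<open>P \<noteq> {\<zero>}\<close> PIdl_zero by blast
    have div: "\<exists>e\<in>D. m = e \<otimes> g" if "m \<in> M" for m
      using that P(2) g(2) by (auto simp: cgenideal_def)
    have gP: "g \<in> P" unfolding g(2) cgenideal_def using g(1) by (auto intro!: exI[of _ \<one>])
    define J where "J = {e \<in> D. e \<otimes> g \<in> M}"
    have JI: "ideal J R"
      unfolding ideal_R_iff J_def
      using g(1) ideal_zero[OF M] ideal_add[OF M] ideal_mult[OF M]
      by (auto simp: l_distr m_assoc)
    have MJ: "M \<subseteq> J"
      using ideal_subset[OF M] ideal_mult[OF M g(1)] g(1) unfolding J_def by (auto simp: m_comm)
    have "J = M"
    proof (rule ccontr)
      assume "J \<noteq> M"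
      then obtain h where h: "h \<in> D" "J = PIdl\<^bsub>R\<^esub> h" using max JI MJ by blast
      have "M = PIdl\<^bsub>R\<^esub> (h \<otimes> g)"
      proof (intro equalityI subsetI)
        fix m assume "m \<in> M"
        then obtain e where e: "e \<in> D" "m = e \<otimes> g" using div by blast
        then have "e \<in> PIdl\<^bsub>R\<^esub> h" using h(2) \<open>m \<in> M\<close> unfolding J_def by blast
        then obtain d where "d \<in> D" "e = d \<otimes> h" by (auto simp: cgenideal_def)
        then show "m \<in> PIdl\<^bsub>R\<^esub> (h \<otimes> g)"
          using e(2) h(1) g(1) by (auto simp: cgenideal_def m_assoc)
      next
        fix m assume "m \<in> PIdl\<^bsub>R\<^esub> (h \<otimes> g)"
        then obtain d where d: "d \<in> D" "m = (d \<otimes> h) \<otimes> g"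
          using h(1) g(1) by (auto simp: cgenideal_def m_assoc)
        have "d \<otimes> h \<in> J" unfolding h(2) cgenideal_def using d by auto
        then show "m \<in> M" using d unfolding J_def by simp
      qed
      then show False using np h(1) g(1) by simp
    qed
    have ig: "inv g \<in> carrier K" "inv g \<otimes> g = \<one>" using g0 g(1) by (auto simp: field_Units)
    have "inv g \<otimes> m \<in> M" if m: "m \<in> M" for m
    proof -
      obtain e where e: "e \<in> D" "m = e \<otimes> g" using div[OF m] by blast
      have "inv g \<otimes> m = (inv g \<otimes> g) \<otimes> e"
        unfolding e(2) using e(1) g(1) ig(1) by (simp add: m_ac)
      then have "inv g \<otimes> m = e" using e(1) ig(2) by simp
      moreover have "e \<in> J" using e m unfolding J_def by blast
      ultimately show ?thesis using \<open>J = M\<close> by simp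
    qed
    then have "inv g \<in> D" using integral_multiplier_mem[OF M x ig(1)] by blast
    then have "\<one> \<in> P" using ideal_mult[OF PI _ gP] ig(2) by metis
    then show False using P1 by contradiction
  qed
qed

section \<open>Idempotent pairs in a subring with nonzero conductor\<close>

text \<open>The subring \<open>A\<close> of \<open>D\<close> comes with a nonzero element
  \<open>c\<close> of its conductor, so that it may be an order or \<open>D\<close> itself.\<close>

lemma principal_domain_if_PRINC_subring:
  assumes A: "subring A K" "A \<subseteq> D" and c: "c \<in> A" "c \<noteq> \<zero>"
    and conductor: "\<And>d. d \<in> D \<Longrightarrow> c \<otimes> d \<in> A"
    and PRINC: "PRINC_domain (K\<lparr>carrier := A\<rparr>)"
  shows "principal_domain R"
proof (rule principal_domain_if_primes_principal)
  let ?A = "K\<lparr>carrier := A\<rparr>"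
  fix P assume P: "primeideal P R" "P \<noteq> {\<zero>}"
  have PI: "ideal P R" using P(1) by (simp add: primeideal_R_iff)
  have cD: "c \<in> D" using c A by blast
  have "c \<otimes> c \<in> D" "c \<otimes> c \<noteq> \<zero>"
    using cD c(2) integral[of c c] by auto
  then obtain r b where r: "r \<in> P" and b: "b \<in> P"
    and rb: "\<And>m. m \<in> P \<Longrightarrow> \<exists>d\<in>D. (\<one> \<ominus> (c \<otimes> c) \<otimes> r) \<otimes> m = b \<otimes> d"
    using prime_locally_generated[OF P] by blast
  note rD = ideal_subset[OF PI r] and bD = ideal_subset[OF PI b]
  \<comment> \<open>\<open>a\<close> carries \<open>c^2\<close>: in
    \<open>a (1 - a) = (c d) b'\<close> one factor \<open>c\<close> goes into \<open>b'\<close>, the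
    other puts the cofactor \<open>c d\<close> into \<open>A\<close>.\<close>
  define a where "a = (c \<otimes> c) \<otimes> r"
  define b' where "b' = c \<otimes> b"
  have aA: "a \<in> A" using conductor[of "c \<otimes> r"] cD rD unfolding a_def by (simp add: m_assoc)
  have bA: "b' \<in> A" using conductor[OF bD] unfolding b'_def .
  have K: "a \<in> carrier K" "b' \<in> carrier K" "b \<in> carrier K" "r \<in> carrier K" "c \<in> carrier K"
    using aA bA bD rD cD A by auto
  have cringA: "cring ?A" and domA: "domain ?A"
    using PRINC domain.axioms(1) unfolding PRINC_domain_def by auto
  obtain d where d: "d \<in> D" "(\<one> \<ominus> a) \<otimes> r = b \<otimes> d" using rb[OF r] unfolding a_def by blast
  have "a \<otimes> (\<one> \<ominus> a) = (c \<otimes> c) \<otimes> ((\<one> \<ominus> a) \<otimes> r)"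
    using K by (simp add: a_def m_ac)
  also have "\<dots> = (c \<otimes> d) \<otimes> b'" unfolding d(2) b'_def using K d by (simp add: m_ac)
  finally have "a \<otimes>\<^bsub>?A\<^esub> (\<one>\<^bsub>?A\<^esub> \<ominus>\<^bsub>?A\<^esub> a) \<in> PIdl\<^bsub>?A\<^esub> b'"
    using conductor[OF d(1)] a_inv_subring[OF A(1) aA] by (auto simp: cgenideal_def a_minus_def)
  then have "idempotent_pair ?A a b'" unfolding idempotent_pair_def using aA bA by simp
  then have "principalideal (Idl\<^bsub>?A\<^esub> {a, b'}) ?A" using PRINC unfolding PRINC_domain_def by blast
  then obtain g where g: "g \<in> A" "Idl\<^bsub>?A\<^esub> {a, b'} = PIdl\<^bsub>?A\<^esub> g"
    using principalideal.generate cring.cgenideal_eq_genideal[OF cringA] by fastforce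
  have ringA: "ring ?A" using cringA by (rule cring.axioms(1))
  have "{a, b'} \<subseteq> PIdl\<^bsub>?A\<^esub> g" using ring.genideal_self[OF ringA, of "{a, b'}"] aA bA g by simp
  then obtain s t where st: "s \<in> A" "t \<in> A" "a = s \<otimes> g" "b' = t \<otimes> g" by (auto simp: cgenideal_def)
  \<comment> \<open>An ideal of \<open>A\<close> containing \<open>a\<close> and \<open>b'\<close>,
    hence also \<open>g\<close>, which is thereby an explicit \<open>A\<close>-combination of
    them.\<close>
  let ?S = "{u \<otimes> a \<oplus> v \<otimes> b' | u v. u \<in> A \<and> v \<in> A}"
  note AE = subringE[OF A(1)]
  have AK: "x \<in> carrier K" if "x \<in> A" for x using that A by auto
  have SI: "ideal ?S ?A"
    unfolding ideal_subring_iff[OF A(1)]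
  proof (intro conjI ballI subsetI)
    show "\<zero> \<in> ?S" using AE(2) K by (auto intro!: exI[of _ \<zero>])
  next
    fix x assume "x \<in> ?S" then show "x \<in> A" using AE(6,7) aA bA by auto
  next
    fix x y assume "x \<in> ?S" "y \<in> ?S"
    then obtain u v u' v' where uv: "u \<in> A" "v \<in> A" "u' \<in> A" "v' \<in> A"
      "x = u \<otimes> a \<oplus> v \<otimes> b'" "y = u' \<otimes> a \<oplus> v' \<otimes> b'" by blast
    have "u \<in> carrier K" "v \<in> carrier K" "u' \<in> carrier K" "v' \<in> carrier K"
      using uv AK by auto
    then have "x \<oplus> y = (u \<oplus> u') \<otimes> a \<oplus> (v \<oplus> v') \<otimes> b'"
      unfolding uv(5,6) using K(1,2) by algebra
    then show "x \<oplus> y \<in> ?S" using AE(7) uv by blast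
  next
    fix e x assume e: "e \<in> A" "x \<in> ?S"
    then obtain u v where uv: "u \<in> A" "v \<in> A" "x = u \<otimes> a \<oplus> v \<otimes> b'" by blast
    have "e \<otimes> x = (e \<otimes> u) \<otimes> a \<oplus> (e \<otimes> v) \<otimes> b'"
      unfolding uv(3) using K uv e AK by (simp add: r_distr m_assoc)
    then show "e \<otimes> x \<in> ?S" using AE(6) uv e by blast
  qed
  have "{a, b'} \<subseteq> ?S"
  proof -
    have "a = \<one> \<otimes> a \<oplus> \<zero> \<otimes> b'" "b' = \<zero> \<otimes> a \<oplus> \<one> \<otimes> b'" using K by auto
    then show ?thesis using AE(2,3) by blast
  qed
  then have "Idl\<^bsub>?A\<^esub> {a, b'} \<subseteq> ?S" by (rule ring.genideal_minimal[OF ringA SI])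
  moreover have "g \<in> PIdl\<^bsub>?A\<^esub> g" using ring.cgenideal_self[OF ringA] g(1) by simp
  ultimately have "g \<in> ?S" unfolding g(2) by blast
  then obtain u v where uv: "u \<in> A" "v \<in> A" "g = u \<otimes> a \<oplus> v \<otimes> b'" by blast
  \<comment> \<open>\<open>h\<close> is \<open>g / c\<close>: dividing \<open>a\<close> and
    \<open>b'\<close> by \<open>c\<close> leaves \<open>c r\<close> and \<open>b\<close>, both in
    \<open>P\<close>.\<close>
  define h where "h = (u \<otimes> c) \<otimes> r \<oplus> v \<otimes> b"
  have uvD: "u \<in> D" "v \<in> D" "s \<in> D" "t \<in> D" using uv st A by auto
  have hP: "h \<in> P" unfolding h_def
    using uvD cD by (intro ideal_add[OF PI] ideal_mult[OF PI] r b) auto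
  have hK: "h \<in> carrier K" using ideal_subset[OF PI hP] by simp
  have gh: "g = c \<otimes> h"
    unfolding uv(3) h_def a_def b'_def using K uvD by (simp add: r_distr m_ac)
  have "P = PIdl\<^bsub>R\<^esub> h"
  proof (intro equalityI subsetI)
    fix m assume "m \<in> PIdl\<^bsub>R\<^esub> h"
    then show "m \<in> P" using ideal_mult[OF PI _ hP] by (auto simp: cgenideal_def)
  next
    fix m assume m: "m \<in> P"
    then obtain e where e: "e \<in> D" "(\<one> \<ominus> a) \<otimes> m = b \<otimes> e" using rb unfolding a_def by blast
    have mD: "m \<in> D" using ideal_subset[OF PI m] .
    have mK: "m \<in> carrier K" "e \<in> carrier K" "s \<in> carrier K" "t \<in> carrier K"
      using mD e uvD by auto
    \<comment> \<open>Splitting \<open>m\<close> as \<open>a m + (1 - a) m\<close> shows that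
      \<open>c m\<close> is a \<open>D\<close>-combination of \<open>a\<close> and
      \<open>b'\<close>, hence a multiple of \<open>g = c h\<close>; cancelling \<open>c\<close>
      makes \<open>h\<close> a divisor of \<open>m\<close>.\<close>
    have "c \<otimes> m = c \<otimes> (a \<otimes> m) \<oplus> c \<otimes> ((\<one> \<ominus> a) \<otimes> m)" using K(1,5) mK by algebra
    also have "\<dots> = c \<otimes> (a \<otimes> m) \<oplus> b' \<otimes> e" unfolding e(2) b'_def using K mK by (simp add: m_assoc)
    also have "\<dots> = c \<otimes> ((s \<otimes> (c \<otimes> h)) \<otimes> m) \<oplus> (t \<otimes> (c \<otimes> h)) \<otimes> e"
      using st(3,4) gh by simp
    also have "\<dots> = c \<otimes> ((s \<otimes> c \<otimes> m \<oplus> t \<otimes> e) \<otimes> h)"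
      using K(5) mK hK by algebra
    finally have "m = (s \<otimes> c \<otimes> m \<oplus> t \<otimes> e) \<otimes> h"
      using m_lcancel[OF c(2) K(5)] mK hK K(5) by simp
    then show "m \<in> PIdl\<^bsub>R\<^esub> h"
      unfolding cgenideal_def using uvD cD mD e(1) by auto
  qed
  then show "\<exists>g\<in>D. P = PIdl\<^bsub>R\<^esub> g" using ideal_subset[OF PI hP] by blast
qed

end

section \<open>Orders: a nonzero conductor element, and the conclusion\<close>

lemma subset_integral_closure:
  assumes "quotient_field_of K A"
  shows "A \<subseteq> integral_closure K A"
proof
  interpret field K using assms by (simp add: quotient_field_of_def)
  have A: "subdomain A K" using assms by (simp add: quotient_field_of_def)
  note AE = subdomainE[OF A]
  fix x assume x: "x \<in> A"
  then have xK: "x \<in> carrier K" using AE(1) by blast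
  have "polynomial\<^bsub>K\<^esub> A [\<one>\<^bsub>K\<^esub>, \<ominus>\<^bsub>K\<^esub> x]" using AE x by (simp add: polynomial_def)
  moreover have "eval [\<one>\<^bsub>K\<^esub>, \<ominus>\<^bsub>K\<^esub> x] x = \<zero>\<^bsub>K\<^esub>" using xK by (simp add: r_neg)
  ultimately show "x \<in> integral_closure K A"
    unfolding integral_closure_def using xK
    by (intro CollectI conjI exI[of _ "[\<one>\<^bsub>K\<^esub>, \<ominus>\<^bsub>K\<^esub> x]"]) simp_all
qed

text \<open>By induction on \<open>us\<close>: write the new generator as \<open>a / b\<close> and
  multiply the denominator found so far by \<open>b\<close>. When the span is the integral closure,
  \<open>c\<close> is a nonzero element of the conductor.\<close>

lemma Span_common_denominator:
  assumes "quotient_field_of K A" "set us \<subseteq> carrier K"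
  shows "\<exists>c\<in>A. c \<noteq> \<zero>\<^bsub>K\<^esub> \<and> (\<forall>v\<in>ring.Span K A us. v \<in> carrier K \<and> c \<otimes>\<^bsub>K\<^esub> v \<in> A)"
proof -
  interpret field K using assms by (simp add: quotient_field_of_def)
  have A: "subdomain A K" using assms by (simp add: quotient_field_of_def)
  note AE = subdomainE[OF A]
  have AK: "a \<in> carrier K" if "a \<in> A" for a using that AE(1) by blast
  from assms(2) show ?thesis
  proof (induction us)
    case Nil
    then show ?case using AE by (auto intro!: bexI[of _ "\<one>\<^bsub>K\<^esub>"])
  next
    case (Cons u us)
    then obtain c where c: "c \<in> A" "c \<noteq> \<zero>\<^bsub>K\<^esub>"
      and cv: "\<And>v. v \<in> Span A us \<Longrightarrow> v \<in> carrier K \<and> c \<otimes>\<^bsub>K\<^esub> v \<in> A" by auto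
    obtain a b where ab: "a \<in> A" "b \<in> A" "b \<noteq> \<zero>\<^bsub>K\<^esub>" "u = a \<otimes>\<^bsub>K\<^esub> inv\<^bsub>K\<^esub> b"
      using assms(1) Cons.prems unfolding quotient_field_of_def by auto
    have ib: "inv\<^bsub>K\<^esub> b \<in> carrier K" "inv\<^bsub>K\<^esub> b \<otimes>\<^bsub>K\<^esub> b = \<one>\<^bsub>K\<^esub>"
      using ab AK by (auto simp: field_Units)
    have bu: "b \<otimes>\<^bsub>K\<^esub> u = a"
    proof -
      have "b \<otimes>\<^bsub>K\<^esub> u = a \<otimes>\<^bsub>K\<^esub> (inv\<^bsub>K\<^esub> b \<otimes>\<^bsub>K\<^esub> b)"
        unfolding ab(4) using ab AK ib(1) by (simp add: m_ac)
      then show ?thesis using ib(2) ab AK by simp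
    qed
    show ?case
    proof (intro bexI conjI ballI)
      show "c \<otimes>\<^bsub>K\<^esub> b \<in> A" using c ab AE by blast
      show "c \<otimes>\<^bsub>K\<^esub> b \<noteq> \<zero>\<^bsub>K\<^esub>" using c ab AK integral by blast
      fix v assume "v \<in> ring.Span K A (u # us)"
      then obtain k w where kw: "k \<in> A" "w \<in> Span A us" "v = k \<otimes>\<^bsub>K\<^esub> u \<oplus>\<^bsub>K\<^esub> w"
        using line_extension_mem_iff by auto
      have K: "k \<in> carrier K" "w \<in> carrier K" "c \<in> carrier K" "b \<in> carrier K" "u \<in> carrier K"
        using kw c ab AK cv Cons.prems by auto
      then show "v \<in> carrier K" unfolding kw(3) by simp
      have "c \<otimes>\<^bsub>K\<^esub> b \<otimes>\<^bsub>K\<^esub> v = c \<otimes>\<^bsub>K\<^esub> k \<otimes>\<^bsub>K\<^esub> (b \<otimes>\<^bsub>K\<^esub> u) \<oplus>\<^bsub>K\<^esub> b \<otimes>\<^bsub>K\<^esub> (c \<otimes>\<^bsub>K\<^esub> w)"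
        unfolding kw(3) using K by algebra
      then show "c \<otimes>\<^bsub>K\<^esub> b \<otimes>\<^bsub>K\<^esub> v \<in> A"
        unfolding bu using c ab kw cv AE(6,7) by simp
    qed
  qed
qed

lemma principal_domain_imp_PRINC_domain:
  assumes "principal_domain R"
  shows "PRINC_domain R"
proof -
  interpret principal_domain R by fact
  have "principalideal (Idl\<^bsub>R\<^esub> {a, b}) R" if "idempotent_pair R a b" for a b
  proof (rule principalidealI)
    show I: "ideal (Idl\<^bsub>R\<^esub> {a, b}) R"
      using that unfolding idempotent_pair_def by (intro genideal_ideal) auto
    show "\<exists>i\<in>carrier R. Idl\<^bsub>R\<^esub> {a, b} = Idl\<^bsub>R\<^esub> {i}"
      using exists_gen[OF I] cgenideal_eq_genideal by metis
  qed
  then show ?thesis unfolding PRINC_domain_def using domain_axioms by blast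
qed

theorem corollary2p7:
  fixes K :: "('a, 'b) ring_scheme" and A D :: "'a set"
  assumes "order_domain K A"
    and "D = integral_closure K A"
  shows "(PRINC_domain (K\<lparr>carrier := A\<rparr>) \<longrightarrow> PRINC_domain (K\<lparr>carrier := D\<rparr>)) \<and>
         (PRINC_domain (K\<lparr>carrier := D\<rparr>) \<longleftrightarrow> principal_domain (K\<lparr>carrier := D\<rparr>))"
proof -
  have qf: "quotient_field_of K A" and ded: "dedekind_domain K D"
    using assms unfolding order_domain_def by auto
  obtain us where us: "set us \<subseteq> D" "D = ring.Span K A us"
    using assms unfolding order_domain_def by auto
  interpret field K using qf by (simp add: quotient_field_of_def)
  interpret dedekind_subring K D by unfold_locales (rule ded)
  have A: "subring A K"
    using qf subdomain.axioms(1) subcring.axioms(1) unfolding quotient_field_of_def by blast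
  have AD: "A \<subseteq> D" using subset_integral_closure[OF qf] assms(2) by simp
  have "set us \<subseteq> carrier K" using us(1) by auto
  then obtain c where c: "c \<in> A" "c \<noteq> \<zero>\<^bsub>K\<^esub>" "\<And>d. d \<in> D \<Longrightarrow> c \<otimes>\<^bsub>K\<^esub> d \<in> A"
    using Span_common_denominator[OF qf] us(2) by metis
  \<comment> \<open>First \<open>A\<close> with the conductor element \<open>c\<close>, then
    \<open>D\<close> itself with conductor element 1.\<close>
  have "principal_domain (K\<lparr>carrier := D\<rparr>)" if "PRINC_domain (K\<lparr>carrier := A\<rparr>)"
    using principal_domain_if_PRINC_subring[OF A AD c that] .
  moreover have "principal_domain (K\<lparr>carrier := D\<rparr>)" if "PRINC_domain (K\<lparr>carrier := D\<rparr>)"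
    by (rule principal_domain_if_PRINC_subring[OF subring_D order_refl D_one one_not_zero _ that])
      simp
  ultimately show ?thesis using principal_domain_imp_PRINC_domain by blast
qed

end
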